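(* Let $d\ge 2$, let $v_1,\dots,v_N\in\mathbb{R}^d$ ($N\ge1$) be distinct points, and let $p_j(x),q_j(x)\in\mathbb{C}[x_1,\dots,x_d]$, $j=1,\dots,N$, be polynomials. Let $$\gamma(t)=(r_1(t),\dots,r_d(t)),\qquad 0\le t\le 1,$$ be a complex curve in $\mathbb{C}^d$ parametrized by rational functions $r_j(t)$ with complex coefficients, $j=1,\dots,d$, which is not contained in any affine hyperplane of $\mathbb{C}^d$. Assume that none of the functions $p_j(\gamma(t))$, $q_j(\gamma(t))$, $j=1,\dots,N$, vanishes identically for $t\in[0,1]$, so that the function $$\phi(t)=\sum_{j=1}^N\frac{q_j(\gamma(t))}{p_j(\gamma(t))}\,e^{-2\pi i\, v_j\cdot\gamma(t)}$$ is defined for all but finitely many points $t\in[0,1]$. Then $\phi(t)$ cannot vanish identically in $t$.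
   Context: For $x,y\in\mathbb{C}^d$, $x\cdot y=x_1y_1+\cdots+x_dy_d$ (no conjugation). An affine hyperplane of $\mathbb{C}^d$ is a translate of a $(d-1)$-dimensional $\mathbb{C}$-linear subspace. "$\phi$ vanishes identically" means $\phi(t)=0$ at all $t\in[0,1]$ where it is defined. *)

theory Defs
  imports
    "HOL-Analysis.Analysis"
    "HOL-Library.Poly_Mapping"
    "HOL-Computational_Algebra.Computational_Algebra"
    "HOL-Computational_Algebra.Field_as_Ring"
begin

text \<open>
  \<open>\<complex>[x\<^sub>1,\<dots>,x\<^sub>d]\<close> is represented by finitely supported coefficient functions on exponent
  vectors; the variables are indexed by the finite type \<open>'n\<close>, so that \<open>d = CARD('n)\<close>.
\<close>

type_synonym 'n cmpoly = "('n \<Rightarrow>\<^sub>0 nat) \<Rightarrow>\<^sub>0 complex"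

definition cmpoly_eval :: "'n::finite cmpoly \<Rightarrow> complex ^ 'n \<Rightarrow> complex" where
  "cmpoly_eval p x =
     (\<Sum>m\<in>Poly_Mapping.keys p.
        Poly_Mapping.lookup p m * (\<Prod>i\<in>UNIV. (x $ i) ^ Poly_Mapping.lookup m i))"

text \<open>
  \<open>\<complex>(t)\<close> is the fraction field of \<open>\<complex>[t]\<close>. Since \<^const>\<open>quot_of_fract\<close> yields the reduced
  fraction, the zeros of its denominator are exactly the poles of the rational function.
\<close>

type_synonym crat = "complex poly fract"

definition crat_defined_at :: "crat \<Rightarrow> complex \<Rightarrow> bool" where
  "crat_defined_at r z \<longleftrightarrow> poly (snd (quot_of_fract r)) z \<noteq> 0"

definition crat_eval :: "crat \<Rightarrow> complex \<Rightarrow> complex" where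
  "crat_eval r z = poly (fst (quot_of_fract r)) z / poly (snd (quot_of_fract r)) z"

definition curve_dom :: "crat ^ 'n \<Rightarrow> real set" where
  "curve_dom r = {t \<in> {0..1}. \<forall>i. crat_defined_at (r $ i) (complex_of_real t)}"

definition curve_at :: "crat ^ 'n \<Rightarrow> real \<Rightarrow> complex ^ 'n" where
  "curve_at r t = (\<chi> i. crat_eval (r $ i) (complex_of_real t))"

text \<open>Linear subspaces and dimension here are over \<open>\<complex>\<close>, hence the \<open>vec\<close> versions.\<close>

definition affine_hyperplane :: "(complex ^ 'n) set \<Rightarrow> bool" where
  "affine_hyperplane H \<longleftrightarrow>
     (\<exists>a S. vec.subspace S \<and> vec.dim S = CARD('n) - 1 \<and> H = (\<lambda>x. a + x) ` S)"

text \<open>Bilinear, without conjugation, unlike the inner product of the library.\<close>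

definition bdot :: "complex ^ 'n \<Rightarrow> complex ^ 'n \<Rightarrow> complex" where
  "bdot x y = (\<Sum>i\<in>UNIV. x $ i * y $ i)"

definition complexify :: "real ^ 'n \<Rightarrow> complex ^ 'n" where
  "complexify v = (\<chi> i. complex_of_real (v $ i))"

definition exp_sum ::
  "nat \<Rightarrow> (nat \<Rightarrow> real ^ 'n) \<Rightarrow> (nat \<Rightarrow> 'n cmpoly) \<Rightarrow> (nat \<Rightarrow> 'n cmpoly) \<Rightarrow> crat ^ 'n
    \<Rightarrow> real \<Rightarrow> complex" where
  "exp_sum N v p q r t =
     (\<Sum>j = 1..N. cmpoly_eval (q j) (curve_at r t) / cmpoly_eval (p j) (curve_at r t) *
        exp (- 2 * complex_of_real pi * \<i> * bdot (complexify (v j)) (curve_at r t)))"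

definition exp_sum_dom :: "nat \<Rightarrow> (nat \<Rightarrow> 'n::finite cmpoly) \<Rightarrow> crat ^ 'n \<Rightarrow> real set" where
  "exp_sum_dom N p r =
     {t \<in> curve_dom r. \<forall>j \<in> {1..N}. cmpoly_eval (p j) (curve_at r t) \<noteq> 0}"

end

theory Submission
  imports Defs
begin

text \<open>
  Over a common denominator, \<open>\<phi>\<close> becomes a sum of terms \<open>a\<^sub>j exp (s\<^sub>j / w)\<close> with polynomials \<open>a\<^sub>j\<close>,
  \<open>s\<^sub>j\<close>, \<open>w\<close>. As the curve lies in no hyperplane \<open>(v\<^sub>j - v\<^sub>k) \<cdot> x = c\<close>, the differences
  \<open>(s\<^sub>j - s\<^sub>k) / w\<close> are not constant. Such exponentials are linearly independent over the
  polynomials: combining a relation with its derivative eliminates one term, and a remaining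
  coefficient could only become zero if a nonconstant rational function had a rational exponential.
\<close>

section \<open>Pole orders and degrees of logarithmic derivatives\<close>

text \<open>The extra factor \<open>[:-z, 1:]\<close> avoids the exponent \<open>n - 1\<close>, so
  one formula covers \<open>n = 0\<close> as well and the full power can be factored out when orders
  at \<open>z\<close> are compared.\<close>

lemma pderiv_linear_power_mult:
  fixes b :: "'a::idom poly"
  shows "[:-z, 1:] * pderiv ([:-z, 1:] ^ n * b) =
    [:-z, 1:] ^ n * ([:-z, 1:] * pderiv b + smult (of_nat n) b)"
proof (cases n)
  case (Suc m)
  have "pderiv [:-z, 1::'a:] = 1"
    by (simp add: pderiv_pCons)
  then have "pderiv ([:-z, 1:] ^ n * b) = [:-z, 1:] ^ n * pderiv b + smult (of_nat n) ([:-z, 1:] ^ m * b)"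
    unfolding Suc
    by (simp add: pderiv_mult pderiv_power_Suc algebra_simps
        del: power_Suc mult_pCons_left mult_pCons_right)
  then show ?thesis
    unfolding Suc by (simp add: algebra_simps del: mult_pCons_left mult_pCons_right)
qed simp

text \<open>Pole orders would clash: by coprimality a zero of \<open>w\<close> is a pole of
  \<open>s / w\<close>, whose derivative then has a pole of order at least two, while the
  logarithmic derivative of \<open>b / a\<close> has at most a simple pole.\<close>

lemma coprime_log_derivative_identity_no_root:
  fixes a b s w :: "'a::{field_char_0,field_gcd} poly"
  assumes eq: "w\<^sup>2 * (a * pderiv b - pderiv a * b) + a * b * (pderiv s * w - s * pderiv w) = 0"
    and nz: "a \<noteq> 0" "b \<noteq> 0" "w \<noteq> 0" and cop: "coprime s w"
  shows "poly w z \<noteq> 0"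
proof
  assume root: "poly w z = 0"
  have sz: "poly s z \<noteq> 0"
  proof
    assume "poly s z = 0"
    with root have "[:-z, 1:] dvd s" "[:-z, 1:] dvd w"
      by (simp_all add: poly_eq_0_iff_dvd)
    with cop have "is_unit [:-z, 1:]"
      by (rule coprime_common_divisor)
    then show False
      by (simp add: is_unit_pCons_iff)
  qed
  define X where "X = [:-z, 1:]"
  have X: "X \<noteq> 0" "poly X z = 0"
    by (simp_all add: X_def)
  have decomp: "\<exists>f0. f = X ^ order z f * f0 \<and> poly f0 z \<noteq> 0" if "f \<noteq> 0" for f
    using order_decomp[OF that, of z] unfolding X_def by (auto simp: poly_eq_0_iff_dvd)
  obtain m a0 where a: "a = X ^ m * a0" "poly a0 z \<noteq> 0"
    using decomp[OF nz(1)] by blast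
  obtain n b0 where b: "b = X ^ n * b0" "poly b0 z \<noteq> 0"
    using decomp[OF nz(2)] by blast
  obtain k w0 where w: "w = X ^ k * w0" "poly w0 z \<noteq> 0"
    using decomp[OF nz(3)] by blast
  have k: "k > 0"
    using w root by (cases k) auto
  have da: "X * pderiv a = X ^ m * (X * pderiv a0 + smult (of_nat m) a0)"
    and db: "X * pderiv b = X ^ n * (X * pderiv b0 + smult (of_nat n) b0)"
    and dw: "X * pderiv w = X ^ k * (X * pderiv w0 + smult (of_nat k) w0)"
    unfolding a b w X_def by (rule pderiv_linear_power_mult)+
  define A where "A = X * pderiv a0 + smult (of_nat m) a0"
  define B where "B = X * pderiv b0 + smult (of_nat n) b0"
  \<comment> \<open>The factor \<open>X\<close> makes \<open>da\<close>, \<open>db\<close> and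
    \<open>dw\<close> applicable; afterwards \<open>X ^ m * X ^ n * X ^ k\<close> cancels.\<close>
  have "0 = w\<^sup>2 * (a * (X * pderiv b) - (X * pderiv a) * b) +
          a * b * (X * pderiv s * w - s * (X * pderiv w))"
    using arg_cong[OF eq, of "\<lambda>f. X * f"] by (simp add: algebra_simps)
  also have "\<dots> = (X ^ m * X ^ n * X ^ k) * (X ^ k * w0\<^sup>2 * (a0 * B - A * b0) +
          a0 * b0 * (X * pderiv s * w0 - s * (X * pderiv w0 + smult (of_nat k) w0)))"
    unfolding da db dw unfolding a b w A_def[symmetric] B_def[symmetric]
    by (simp add: algebra_simps power2_eq_square)
  finally have "X ^ k * w0\<^sup>2 * (a0 * B - A * b0) +
          a0 * b0 * (X * pderiv s * w0 - s * (X * pderiv w0 + smult (of_nat k) w0)) = 0"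
    using X(1) by simp
  then have "poly (X ^ k * w0\<^sup>2 * (a0 * B - A * b0) +
          a0 * b0 * (X * pderiv s * w0 - s * (X * pderiv w0 + smult (of_nat k) w0))) z = 0"
    by simp
  \<comment> \<open>Since \<open>k > 0\<close>, all summands containing \<open>X\<close> vanish at
    \<open>z\<close>; what survives comes from differentiating \<open>X ^ k\<close> in
    \<open>w\<close>.\<close>
  then have "poly a0 z * poly b0 z * (poly s z * (of_nat k * poly w0 z)) = 0"
    using k X(2) by (simp add: zero_power)
  then show False
    using a b w sz k by simp
qed

text \<open>Differentiating one factor either lowers the degree of the product by one or annihilates
  it. The hypothesis excludes two constants, where both degrees would be 0.\<close>

lemma degree_wronskian_less:
  fixes a b :: "'a::field_char_0 poly"
  assumes "a * pderiv b - pderiv a * b \<noteq> 0"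
  shows "degree (a * pderiv b - pderiv a * b) < degree a + degree b"
proof -
  have d: "degree (a * pderiv b) \<le> degree a + (degree b - 1)"
    "degree (pderiv a * b) \<le> (degree a - 1) + degree b"
    using degree_mult_le[of a "pderiv b"] degree_mult_le[of "pderiv a" b]
    by (simp_all add: degree_pderiv)
  have z: "pderiv f = 0" if "degree f = 0" for f :: "'a poly"
    using that by (simp add: pderiv_eq_0_iff)
  have "degree a > 0 \<or> degree b > 0"
    using assms z[of a] z[of b]
    by (metis diff_self mult_zero_left mult_zero_right neq0_conv)
  moreover have "degree a = 0 \<Longrightarrow> pderiv a = 0" "degree b = 0 \<Longrightarrow> pderiv b = 0"
    using z by auto
  ultimately consider "degree a > 0" "degree b > 0"
    | "degree a > 0" "pderiv b = 0" | "degree b > 0" "pderiv a = 0"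
    by auto
  then show ?thesis
  proof cases
    case 1
    with d have "degree (a * pderiv b) < degree a + degree b" "degree (pderiv a * b) < degree a + degree b"
      by linarith+
    then show ?thesis
      by (rule degree_diff_less)
  qed (use d in auto)
qed

text \<open>
  The hypothesis says \<open>R'/R = - S'\<close> for \<open>R = b/a\<close> and \<open>S = s/w\<close>. The left side has at most simple
  poles and vanishes at infinity, whereas \<open>S'\<close> has only multiple poles; so \<open>S\<close> is constant.
\<close>

lemma log_derivative_identity_imp_const:
  fixes a b s w :: "complex poly"
  assumes eq: "w\<^sup>2 * (a * pderiv b - pderiv a * b) + a * b * (pderiv s * w - s * pderiv w) = 0"
    and nz: "a \<noteq> 0" "b \<noteq> 0" "w \<noteq> 0"
  shows "\<exists>c. s = smult c w"
proof -
  \<comment> \<open>Pass to lowest terms, as the comparison of pole orders requires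
    coprimality.\<close>
  define g where "g = gcd s w"
  have g: "g \<noteq> 0"
    using nz by (simp add: g_def)
  obtain s0 w0 where sw: "s = s0 * g" "w = w0 * g" "coprime s0 w0"
    using gcd_coprime_exists[of s w] g unfolding g_def by blast
  have w0: "w0 \<noteq> 0"
    using sw nz by auto
  \<comment> \<open>In the numerator of the quotient rule a common factor \<open>g\<close> of
    \<open>s\<close> and \<open>w\<close> enters only as \<open>g\<^sup>2\<close>, so it
    cancels.\<close>
  have "g\<^sup>2 * (w0\<^sup>2 * (a * pderiv b - pderiv a * b) + a * b * (pderiv s0 * w0 - s0 * pderiv w0)) = 0"
    using eq unfolding sw by (simp add: pderiv_mult algebra_simps power2_eq_square)
  then have eq0: "w0\<^sup>2 * (a * pderiv b - pderiv a * b) + a * b * (pderiv s0 * w0 - s0 * pderiv w0) = 0"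
    using g by simp
  have "poly w0 z \<noteq> 0" for z
    using coprime_log_derivative_identity_no_root[OF eq0 nz(1,2) w0 sw(3)] .
  then have "constant (poly w0)"
    using fundamental_theorem_of_algebra by blast
  then have "degree w0 = 0"
    by (simp add: constant_degree)
  then obtain c where c: "w0 = [:c:]"
    by (rule degree_eq_zeroE)
  have c0: "c \<noteq> 0"
    using w0 c by simp
  have eq1: "smult c (a * pderiv b - pderiv a * b) = - (a * b * pderiv s0)"
  proof -
    have "smult c (smult c (a * pderiv b - pderiv a * b) + a * b * pderiv s0) = 0"
      using eq0 unfolding c
      by (simp add: power2_eq_square pderiv_pCons smult_add_right smult_diff_right algebra_simps)
    then show ?thesis
      using c0 by (simp add: eq_neg_iff_add_eq_0)
  qed
  \<comment> \<open>Comparison at infinity: otherwise the right side of \<open>eq1\<close> has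
    degree at least \<open>degree a + degree b\<close>, too large for the left side.\<close>
  have "pderiv s0 = 0"
  proof (rule ccontr)
    assume s0: "pderiv s0 \<noteq> 0"
    with eq1 nz have "a * pderiv b - pderiv a * b \<noteq> 0"
      by auto
    then have "degree (a * pderiv b - pderiv a * b) < degree a + degree b"
      by (rule degree_wronskian_less)
    moreover have "degree (a * pderiv b - pderiv a * b) = degree (a * b * pderiv s0)"
      using arg_cong[OF eq1, of degree] c0 by simp
    ultimately show False
      using nz s0 by (simp add: degree_mult_eq)
  qed
  then obtain e where "s0 = [:e:]"
    by (auto simp: pderiv_eq_0_iff elim: degree_eq_zeroE)
  then have "s = smult (e / c) w"
    using c0 by (simp add: sw c)
  then show ?thesis ..
qed

section \<open>Linear independence of exponentials of rational functions\<close>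

lemma infinite_open_real:
  fixes U :: "real set"
  assumes "open U" "U \<noteq> {}"
  shows "infinite U"
  using assms finite_imp_not_open by blast

lemma poly_zero_on_infinite_reals:
  fixes f :: "complex poly"
  assumes "infinite U" "\<And>t. t \<in> U \<Longrightarrow> poly f (complex_of_real t) = 0"
  shows "f = 0"
proof (rule ccontr)
  assume "f \<noteq> 0"
  then have "finite {x. poly f x = 0}"
    by (rule poly_roots_finite)
  moreover have "complex_of_real ` U \<subseteq> {x. poly f x = 0}"
    using assms(2) by auto
  ultimately have "finite (complex_of_real ` U)"
    by (rule rev_finite_subset)
  then show False
    using assms(1) by (simp add: finite_image_iff inj_on_def)
qed

text \<open>The set \<open>U\<close> is open so that the relation can be differentiated inside it.
  The induction on \<open>J\<close> keeps \<open>a\<close> arbitrary because eliminating a term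
  changes the remaining coefficients.\<close>

lemma exp_rational_linear_independent:
  fixes a s :: "'i \<Rightarrow> complex poly" and w :: "complex poly"
  assumes "finite J" "open U" "U \<noteq> {}"
    and w: "\<And>t. t \<in> U \<Longrightarrow> poly w (complex_of_real t) \<noteq> 0"
    and "\<And>j k c. j \<in> J \<Longrightarrow> k \<in> J \<Longrightarrow> j \<noteq> k \<Longrightarrow> s j - s k \<noteq> smult c w"
    and "\<And>t. t \<in> U \<Longrightarrow> (\<Sum>j\<in>J. poly (a j) (complex_of_real t) *
           exp (poly (s j) (complex_of_real t) / poly w (complex_of_real t))) = 0"
  shows "\<forall>j\<in>J. a j = 0"
  using assms(1,5,6)
proof (induction J arbitrary: a rule: finite_induct)
  case empty
  then show ?case by simp
next
  case (insert k J)
  let ?E = "\<lambda>j x. exp (poly (s j) x / poly w x)"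
  let ?f = "\<lambda>x. \<Sum>j\<in>insert k J. poly (a j) x * ?E j x"
  have sep: "\<And>j l c. j \<in> J \<Longrightarrow> l \<in> J \<Longrightarrow> j \<noteq> l \<Longrightarrow> s j - s l \<noteq> smult c w"
    using insert.prems(1) by auto
  have zero: "?f (complex_of_real t) = 0" if "t \<in> U" for t
    using insert.prems(2)[OF that] .
  have w0: "w \<noteq> 0"
    using w \<open>U \<noteq> {}\<close> by auto
  show ?case
  proof (cases "a k = 0")
    case True
    then have "\<And>t. t \<in> U \<Longrightarrow> (\<Sum>j\<in>J. poly (a j) (complex_of_real t) * ?E j (complex_of_real t)) = 0"
      using zero insert.hyps by simp
    from insert.IH[OF sep this] True show ?thesis
      by auto
  next
    case False
    \<comment> \<open>\<open>d j / w\<^sup>2\<close> is the coefficient of the exponential in the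
      derivative of the \<open>j\<close>-th term; dropping \<open>w\<^sup>2\<close> keeps it
      polynomial. The combination \<open>b\<close> is chosen so that \<open>b k = 0\<close>.\<close>
    define d where "d = (\<lambda>j. w\<^sup>2 * pderiv (a j) + a j * (pderiv (s j) * w - s j * pderiv w))"
    define b where "b = (\<lambda>j. a k * d j - d k * a j)"
    have deriv_zero: "(\<Sum>j\<in>insert k J. poly (d j) (complex_of_real t) * ?E j (complex_of_real t)) = 0"
      if t: "t \<in> U" for t
    proof -
      let ?x = "complex_of_real t"
      have wt: "poly w ?x \<noteq> 0"
        using w t .
      have summand: "((\<lambda>x. poly (a j) x * ?E j x) has_field_derivative
              poly (d j) ?x * ?E j ?x / (poly w ?x)\<^sup>2) (at ?x)" for j
        using wt by (auto intro!: derivative_eq_intros simp: d_def field_simps power2_eq_square)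
      have "(?f has_field_derivative (\<Sum>j\<in>insert k J. poly (d j) ?x * ?E j ?x / (poly w ?x)\<^sup>2)) (at ?x)"
        by (intro DERIV_sum summand)
      \<comment> \<open>The sum is known to vanish only at real points, so the complex derivative is
        restricted to the real line before being compared with 0.\<close>
      then have "((\<lambda>t. ?f (complex_of_real t)) has_vector_derivative
          (\<Sum>j\<in>insert k J. poly (d j) ?x * ?E j ?x / (poly w ?x)\<^sup>2)) (at t)"
        by (rule has_vector_derivative_real_field)
      moreover have "((\<lambda>t. ?f (complex_of_real t)) has_vector_derivative 0) (at t)"
        by (rule has_vector_derivative_transform_within_open[OF has_vector_derivative_const \<open>open U\<close> t])
           (simp only: zero)
      ultimately have "(\<Sum>j\<in>insert k J. poly (d j) ?x * ?E j ?x / (poly w ?x)\<^sup>2) = 0"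
        by (rule vector_derivative_unique_at)
      then show ?thesis
        using wt by (simp add: sum_divide_distrib[symmetric])
    qed
    have "(\<Sum>j\<in>J. poly (b j) (complex_of_real t) * ?E j (complex_of_real t)) = 0" if t: "t \<in> U" for t
    proof -
      let ?x = "complex_of_real t"
      have "(\<Sum>j\<in>insert k J. poly (b j) ?x * ?E j ?x) =
          poly (a k) ?x * (\<Sum>j\<in>insert k J. poly (d j) ?x * ?E j ?x) - poly (d k) ?x * ?f ?x"
        unfolding sum_distrib_left sum_subtractf[symmetric]
        by (intro sum.cong) (simp_all add: b_def algebra_simps)
      also have "\<dots> = 0"
        by (simp only: deriv_zero[OF t] zero[OF t] mult_zero_right diff_self)
      finally show ?thesis
        using insert.hyps by (simp add: b_def mult.commute)
    qed
    from insert.IH[OF sep this] have b0: "\<forall>j\<in>J. b j = 0" .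
    have aJ: "a j = 0" if j: "j \<in> J" for j
    proof (rule ccontr)
      assume aj: "a j \<noteq> 0"
      \<comment> \<open>\<open>b j = 0\<close> says that \<open>a j / a k\<close> times the
        exponential of \<open>(s j - s k) / w\<close> has derivative zero; written out, it is the
        logarithmic derivative identity.\<close>
      have "w\<^sup>2 * (a k * pderiv (a j) - pderiv (a k) * a j) +
          a k * a j * (pderiv (s j - s k) * w - (s j - s k) * pderiv w) = 0"
        using b0 j by (simp add: b_def d_def pderiv_diff algebra_simps)
      then obtain c where "s j - s k = smult c w"
        using log_derivative_identity_imp_const[OF _ False aj w0] by blast
      then show False
        using insert.prems(1)[of j k c] insert.hyps j by auto
    qed
    \<comment> \<open>Only the term of \<open>k\<close> remains, and its exponential has no
      zeros.\<close>
    have "poly (a k) (complex_of_real t) = 0" if "t \<in> U" for t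
      using zero[OF that] insert.hyps aJ by simp
    then have "a k = 0"
      by (rule poly_zero_on_infinite_reals[OF infinite_open_real[OF assms(2,3)]])
    with False show ?thesis ..
  qed
qed

section \<open>Level sets of linear forms as hyperplanes\<close>

text \<open>The kernel of the form together with one vector \<open>e\<close> outside it spans the
  whole space, so the kernel has codimension one; a multiple of \<open>e\<close> translates it to
  the level \<open>c\<close>.\<close>

lemma affine_hyperplane_bdot:
  fixes u :: "complex ^ 'n"
  assumes "u \<noteq> 0"
  shows "affine_hyperplane {x. bdot u x = c}"
proof -
  obtain k where k: "u $ k \<noteq> 0"
    using assms by (auto simp: vec_eq_iff)
  let ?S = "{x. bdot u x = 0}"
  define e :: "complex ^ 'n" where "e = axis k 1"
  have ue: "bdot u e = u $ k"
    by (simp add: bdot_def e_def axis_def if_distrib cong: if_cong)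
  have add: "bdot u (x + y) = bdot u x + bdot u y" for x y
    by (simp add: bdot_def algebra_simps sum.distrib)
  have scale: "bdot u (l *s x) = l * bdot u x" for l x
    by (simp add: bdot_def sum_distrib_left algebra_simps)
  have diff: "bdot u (x - y) = bdot u x - bdot u y" for x y
    by (simp add: bdot_def algebra_simps sum_subtractf)
  have S: "vec.subspace ?S"
    by (rule vec.subspaceI) (simp_all add: add scale, simp add: bdot_def)
  have "vec.span (insert e ?S) = UNIV"
  proof -
    have "x \<in> vec.span (insert e ?S)" for x
    proof -
      let ?l = "bdot u x / u $ k"
      have "x - ?l *s e \<in> vec.span (insert e ?S)"
        by (rule vec.span_base) (use k in \<open>simp add: diff scale ue\<close>)
      moreover have "?l *s e \<in> vec.span (insert e ?S)"
        by (intro vec.span_scale vec.span_base) simp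
      ultimately have "(x - ?l *s e) + ?l *s e \<in> vec.span (insert e ?S)"
        by (rule vec.span_add)
      then show ?thesis by simp
    qed
    then show ?thesis by auto
  qed
  then have "vec.dim (insert e ?S) = CARD('n)"
    by (metis vec.dim_span vec_dim_card)
  moreover have "e \<notin> vec.span ?S"
    using k ue S by (metis (mono_tags, lifting) mem_Collect_eq vec.span_eq_iff)
  ultimately have "vec.dim ?S = CARD('n) - 1"
    by (simp add: vec.dim_insert)
  moreover have "{x. bdot u x = c} = (\<lambda>x. (c / u $ k) *s e + x) ` ?S"
  proof (intro equalityI subsetI)
    fix x assume "x \<in> {x. bdot u x = c}"
    then have "x - (c / u $ k) *s e \<in> ?S"
      using k by (simp add: diff scale ue)
    then show "x \<in> (\<lambda>x. (c / u $ k) *s e + x) ` ?S"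
      by (intro image_eqI[of _ _ "x - (c / u $ k) *s e"]) auto
  qed (use k in \<open>auto simp: add scale ue\<close>)
  ultimately show ?thesis
    unfolding affine_hyperplane_def using S by blast
qed

section \<open>Polynomials along the curve over a common denominator\<close>

text \<open>One denominator shared by all coordinates; its zeros are exactly the poles of the
  coordinates.\<close>

definition curve_denom :: "crat ^ 'n::finite \<Rightarrow> complex poly" where
  "curve_denom r = (\<Prod>i\<in>UNIV. snd (quot_of_fract (r $ i)))"

definition curve_numer :: "crat ^ 'n::finite \<Rightarrow> 'n \<Rightarrow> complex poly" where
  "curve_numer r i = fst (quot_of_fract (r $ i)) * (\<Prod>k\<in>UNIV - {i}. snd (quot_of_fract (r $ k)))"

lemma curve_denom_nonzero: "curve_denom r \<noteq> 0"
  by (simp add: curve_denom_def)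

lemma curve_dom_iff:
  "t \<in> curve_dom r \<longleftrightarrow> t \<in> {0..1} \<and> poly (curve_denom r) (complex_of_real t) \<noteq> 0"
  by (simp add: curve_dom_def curve_denom_def crat_defined_at_def poly_prod)

lemma curve_at_nth:
  assumes "t \<in> curve_dom r"
  shows "curve_at r t $ i =
    poly (curve_numer r i) (complex_of_real t) / poly (curve_denom r) (complex_of_real t)"
proof -
  have "curve_denom r = snd (quot_of_fract (r $ i)) * (\<Prod>k\<in>UNIV - {i}. snd (quot_of_fract (r $ k)))"
    unfolding curve_denom_def by (rule prod.remove) simp_all
  then show ?thesis
    using assms by (simp add: curve_dom_iff curve_at_def crat_eval_def curve_numer_def)
qed

lemma bdot_complexify_curve_at:
  assumes "t \<in> curve_dom r"
  shows "bdot (complexify u) (curve_at r t) =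
    poly (\<Sum>i\<in>UNIV. smult (complex_of_real (u $ i)) (curve_numer r i)) (complex_of_real t) /
    poly (curve_denom r) (complex_of_real t)"
  by (simp add: bdot_def complexify_def curve_at_nth[OF assms] poly_sum sum_divide_distrib)

text \<open>Two summands cleared by different powers of \<open>D\<close> are both cleared by the
  product of these powers. \<open>P\<close> and \<open>M\<close> are chosen before \<open>t\<close>,
  so they serve all parameters at once.\<close>

lemma clear_denominator_sum:
  fixes D :: "'a::field poly" and f :: "'i \<Rightarrow> 'b \<Rightarrow> 'a"
  assumes "finite A" "\<And>i. i \<in> A \<Longrightarrow> \<exists>P M. \<forall>t\<in>T. f i t * poly D (h t) ^ M = poly P (h t)"
  shows "\<exists>P M. \<forall>t\<in>T. (\<Sum>i\<in>A. f i t) * poly D (h t) ^ M = poly P (h t)"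
  using assms
proof (induction A rule: finite_induct)
  case empty
  show ?case by (auto intro!: exI[of _ 0])
next
  case (insert i A)
  obtain P M Q L where P: "\<forall>t\<in>T. f i t * poly D (h t) ^ M = poly P (h t)"
    and Q: "\<forall>t\<in>T. (\<Sum>i\<in>A. f i t) * poly D (h t) ^ L = poly Q (h t)"
    using insert by (metis insertI1 insertI2)
  have "\<forall>t\<in>T. (\<Sum>i\<in>insert i A. f i t) * poly D (h t) ^ (M + L) = poly (P * D ^ L + Q * D ^ M) (h t)"
    using insert.hyps P[rule_format, symmetric] Q[rule_format, symmetric]
    by (simp add: power_add algebra_simps)
  then show ?case by blast
qed

text \<open>A monomial is cleared by the power of \<open>curve_denom r\<close> whose exponent is its
  total degree.\<close>

lemma cmpoly_eval_curve_at:
  fixes r :: "crat ^ 'n"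
  shows "\<exists>P M. \<forall>t\<in>curve_dom r. cmpoly_eval p (curve_at r t) *
    poly (curve_denom r) (complex_of_real t) ^ M = poly P (complex_of_real t)"
  unfolding cmpoly_eval_def
proof (rule clear_denominator_sum)
  fix m :: "'n \<Rightarrow>\<^sub>0 nat"
  let ?c = "Poly_Mapping.lookup p m" and ?e = "Poly_Mapping.lookup m"
  have "?c * (\<Prod>i\<in>UNIV. (curve_at r t $ i) ^ ?e i) *
      poly (curve_denom r) (complex_of_real t) ^ (\<Sum>i\<in>UNIV. ?e i) =
      poly (smult ?c (\<Prod>i\<in>UNIV. curve_numer r i ^ ?e i)) (complex_of_real t)"
    if t: "t \<in> curve_dom r" for t
    using t unfolding power_sum
    by (simp add: curve_dom_iff curve_at_nth[OF t] poly_prod power_divide prod_dividef)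
  then show "\<exists>P M. \<forall>t\<in>curve_dom r. ?c * (\<Prod>i\<in>UNIV. (curve_at r t $ i) ^ ?e i) *
      poly (curve_denom r) (complex_of_real t) ^ M = poly P (complex_of_real t)"
    by blast
qed simp

text \<open>A zero numerator would make the quotient vanish on all of
  \<open>curve_dom r\<close>.\<close>

lemma cmpoly_eval_curve_at_nonzero:
  fixes r :: "crat ^ 'n"
  assumes "\<not> (\<forall>t\<in>curve_dom r. cmpoly_eval p (curve_at r t) = 0)"
  shows "\<exists>P M. P \<noteq> 0 \<and> (\<forall>t\<in>curve_dom r. cmpoly_eval p (curve_at r t) =
    poly P (complex_of_real t) / poly (curve_denom r ^ M) (complex_of_real t))"
proof -
  obtain P M where PM: "\<forall>t\<in>curve_dom r. cmpoly_eval p (curve_at r t) *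
      poly (curve_denom r) (complex_of_real t) ^ M = poly P (complex_of_real t)"
    using cmpoly_eval_curve_at by blast
  have eq: "cmpoly_eval p (curve_at r t) =
      poly P (complex_of_real t) / poly (curve_denom r ^ M) (complex_of_real t)"
    if "t \<in> curve_dom r" for t
    using PM that by (simp add: curve_dom_iff eq_divide_eq)
  moreover have "P \<noteq> 0"
    using assms eq by auto
  ultimately show ?thesis
    by blast
qed

section \<open>The exponential sum on the curve\<close>

lemma finite_real_poly_roots:
  fixes f :: "complex poly"
  assumes "f \<noteq> 0"
  shows "finite {t. poly f (complex_of_real t) = 0}"
proof (rule ccontr)
  assume "infinite {t. poly f (complex_of_real t) = 0}"
  then have "f = 0"
    by (rule poly_zero_on_infinite_reals) simp
  with assms show False ..
qed

theorem corollary3p1: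
  fixes N :: nat
    and v :: "nat \<Rightarrow> real ^ 'n"
    and p q :: "nat \<Rightarrow> 'n cmpoly"
    and r :: "crat ^ 'n"
  assumes "CARD('n) \<ge> 2"
    and "N \<ge> 1"
    and "inj_on v {1..N}"
    and "\<And>H. affine_hyperplane H \<Longrightarrow> \<not> curve_at r ` curve_dom r \<subseteq> H"
    and "\<And>j. j \<in> {1..N} \<Longrightarrow> \<not> (\<forall>t \<in> curve_dom r. cmpoly_eval (p j) (curve_at r t) = 0)"
    and "\<And>j. j \<in> {1..N} \<Longrightarrow> \<not> (\<forall>t \<in> curve_dom r. cmpoly_eval (q j) (curve_at r t) = 0)"
  shows "finite ({0..1} - exp_sum_dom N p r) \<and>
         \<not> (\<forall>t \<in> exp_sum_dom N p r. exp_sum N v p q r t = 0)"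
proof -
  define D where "D = curve_denom r"
  have D0: "D \<noteq> 0"
    by (simp add: D_def curve_denom_nonzero)
  have "\<forall>j\<in>{1..N}. \<exists>P M. P \<noteq> 0 \<and> (\<forall>t\<in>curve_dom r. cmpoly_eval (p j) (curve_at r t) =
      poly P (complex_of_real t) / poly (D ^ M) (complex_of_real t))"
    unfolding D_def by (intro ballI cmpoly_eval_curve_at_nonzero assms(5))
  then obtain P K where P: "\<And>j. j \<in> {1..N} \<Longrightarrow> P j \<noteq> 0"
    "\<And>j t. j \<in> {1..N} \<Longrightarrow> t \<in> curve_dom r \<Longrightarrow> cmpoly_eval (p j) (curve_at r t) =
      poly (P j) (complex_of_real t) / poly (D ^ K j) (complex_of_real t)"
    by metis
  have "\<forall>j\<in>{1..N}. \<exists>Q M. Q \<noteq> 0 \<and> (\<forall>t\<in>curve_dom r. cmpoly_eval (q j) (curve_at r t) =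
      poly Q (complex_of_real t) / poly (D ^ M) (complex_of_real t))"
    unfolding D_def by (intro ballI cmpoly_eval_curve_at_nonzero assms(6))
  then obtain Q L where Q: "\<And>j. j \<in> {1..N} \<Longrightarrow> Q j \<noteq> 0"
    "\<And>j t. j \<in> {1..N} \<Longrightarrow> t \<in> curve_dom r \<Longrightarrow> cmpoly_eval (q j) (curve_at r t) =
      poly (Q j) (complex_of_real t) / poly (D ^ L j) (complex_of_real t)"
    by metis

  \<comment> \<open>The roots of \<open>F\<close> in \<open>{0..1}\<close> are the excluded
    parameters: poles of the curve from \<open>D\<close>, zeros of the denominators
    \<open>p j\<close> from \<open>P j\<close>.\<close>
  define F where "F = D * (\<Prod>j\<in>{1..N}. P j)"
  have F0: "F \<noteq> 0"
    using D0 P(1) by (simp add: F_def)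
  have dom: "exp_sum_dom N p r = {0..1} - {t. poly F (complex_of_real t) = 0}"
    using P(2) by (auto simp: exp_sum_dom_def curve_dom_iff F_def poly_prod D_def[symmetric])
  have fin: "finite {t. poly F (complex_of_real t) = 0}"
    using F0 by (rule finite_real_poly_roots)
  have "\<not> (\<forall>t \<in> exp_sum_dom N p r. exp_sum N v p q r t = 0)"
  proof
    assume vanish: "\<forall>t \<in> exp_sum_dom N p r. exp_sum N v p q r t = 0"
    define U where "U = {0<..<1} - {t. poly F (complex_of_real t) = 0}"
    have U: "open U" "U \<noteq> {}"
    proof -
      show "open U"
        unfolding U_def using fin by (intro open_Diff finite_imp_closed) auto
      have "infinite {0<..<1::real}"
        by (simp add: infinite_Ioo)
      then have "infinite U"
        unfolding U_def using fin by simp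
      then show "U \<noteq> {}"
        by auto
    qed
    have U_dom: "t \<in> exp_sum_dom N p r" "t \<in> curve_dom r" if "t \<in> U" for t
      using that dom by (auto simp: U_def exp_sum_dom_def)
    have DU: "poly D (complex_of_real t) \<noteq> 0" if "t \<in> U" for t
      using that by (auto simp: U_def F_def)
    have PU: "poly (P j) (complex_of_real t) \<noteq> 0" if "t \<in> U" "j \<in> {1..N}" for t j
      using that by (auto simp: U_def F_def poly_prod)

    \<comment> \<open>\<open>\<sigma> u\<close> is the numerator over \<open>D\<close> of the form
      given by \<open>u\<close> along the curve; it is linear in \<open>u\<close>.\<close>
    define \<sigma> where "\<sigma> = (\<lambda>u :: real ^ 'n. \<Sum>i\<in>UNIV. smult (complex_of_real (u $ i)) (curve_numer r i))"
    have dot: "bdot (complexify u) (curve_at r t) = poly (\<sigma> u) (complex_of_real t) / poly D (complex_of_real t)"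
      if "t \<in> curve_dom r" for u t
      using bdot_complexify_curve_at[OF that] by (simp only: \<sigma>_def D_def)
    define s where "s = (\<lambda>j. smult (- 2 * complex_of_real pi * \<i>) (\<sigma> (v j)))"
    \<comment> \<open>\<open>q j / p j\<close> equals \<open>Q j * D ^ K j\<close> over
      \<open>P j * D ^ L j\<close>, so multiplying by \<open>G\<close> turns it into the polynomial
      \<open>a j\<close>.\<close>
    define G where "G = (\<Prod>l\<in>{1..N}. P l * D ^ L l)"
    define a where "a = (\<lambda>j. Q j * D ^ K j * (\<Prod>l\<in>{1..N} - {j}. P l * D ^ L l))"

    have "\<forall>j\<in>{1..N}. a j = 0"
    proof (rule exp_rational_linear_independent[OF _ U DU])
      fix j k c
      assume jk: "j \<in> {1..N}" "k \<in> {1..N}" "j \<noteq> k"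
      show "s j - s k \<noteq> smult c D"
      proof
        assume eq: "s j - s k = smult c D"
        \<comment> \<open>A constant difference of exponents would place the curve in a level set of
          the form given by \<open>?u\<close>, a hyperplane because the points \<open>v j\<close>
          and \<open>v k\<close> are distinct.\<close>
        let ?u = "v j - v k"
        let ?b = "- 2 * complex_of_real pi * \<i>"
        have "\<sigma> ?u = \<sigma> (v j) - \<sigma> (v k)"
          by (simp add: \<sigma>_def sum_subtractf[symmetric] smult_diff_left)
        then have *: "smult ?b (\<sigma> ?u) = smult c D"
          using eq by (simp add: s_def smult_diff_right)
        have "bdot (complexify ?u) (curve_at r t) = c / ?b" if t: "t \<in> curve_dom r" for t
        proof -
          have "poly (\<sigma> ?u) (complex_of_real t) * ?b = c * poly D (complex_of_real t)"
            using arg_cong[OF *, of "\<lambda>f. poly f (complex_of_real t)"]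
            by (simp only: poly_smult mult.commute[of ?b])
          moreover have "poly D (complex_of_real t) \<noteq> 0"
            using t by (simp add: curve_dom_iff D_def)
          moreover have "?b \<noteq> 0"
            by simp
          ultimately show ?thesis
            unfolding dot[OF t]
            by (intro frac_eq_eq[THEN iffD2])
        qed
        then have "curve_at r ` curve_dom r \<subseteq> {x. bdot (complexify ?u) x = c / ?b}"
          by blast
        moreover have "complexify ?u \<noteq> 0"
          using inj_onD[OF assms(3), of j k] jk by (auto simp: complexify_def vec_eq_iff)
        ultimately show False
          using assms(4) affine_hyperplane_bdot by blast
      qed
    next
      fix t assume t: "t \<in> U"
      let ?x = "complex_of_real t"
      have "(\<Sum>j\<in>{1..N}. poly (a j) ?x * exp (poly (s j) ?x / poly D ?x)) =
          poly G ?x * exp_sum N v p q r t"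
        unfolding exp_sum_def sum_distrib_left
      proof (rule sum.cong[OF refl])
        fix j assume j: "j \<in> {1..N}"
        have e: "- 2 * complex_of_real pi * \<i> * bdot (complexify (v j)) (curve_at r t) = poly (s j) ?x / poly D ?x"
          unfolding dot[OF U_dom(2)[OF t]]
          by (simp add: s_def)
        have "G = P j * D ^ L j * (\<Prod>l\<in>{1..N} - {j}. P l * D ^ L l)"
          unfolding G_def using j by (intro prod.remove) auto
        then have "poly (a j) ?x = poly G ?x *
            (cmpoly_eval (q j) (curve_at r t) / cmpoly_eval (p j) (curve_at r t))"
          using DU[OF t] PU[OF t j]
          by (simp add: a_def P(2)[OF j U_dom(2)[OF t]] Q(2)[OF j U_dom(2)[OF t]])
        then show "poly (a j) ?x * exp (poly (s j) ?x / poly D ?x) = poly G ?x *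
            (cmpoly_eval (q j) (curve_at r t) / cmpoly_eval (p j) (curve_at r t) *
             exp (- 2 * complex_of_real pi * \<i> * bdot (complexify (v j)) (curve_at r t)))"
          unfolding e by simp
      qed
      then show "(\<Sum>j\<in>{1..N}. poly (a j) ?x * exp (poly (s j) ?x / poly D ?x)) = 0"
        using vanish U_dom(1)[OF t] by simp
    qed simp_all
    \<comment> \<open>The index 1 is available since \<open>N \<ge> 1\<close>, and
      \<open>a 1\<close> is a product of nonzero polynomials.\<close>
    moreover have "a 1 \<noteq> 0"
      using assms(2) P(1) Q(1) D0 by (simp add: a_def)
    ultimately show False
      using assms(2) by simp
  qed
  moreover have "{0..1} - exp_sum_dom N p r \<subseteq> {t. poly F (complex_of_real t) = 0}"
    using dom by auto
  ultimately show ?thesis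
    using fin finite_subset by blast
qed

end
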